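(* Let $\mathfrak{g}$ be an associative complex algebra with unit. For every $k\ge1$, the standard polynomial $\mathcal{A}_{2k}$ defines a $2k$-Lie algebra structure on $\mathfrak{g}$, i.e. $[\mathcal{A}_{2k},\mathcal{A}_{2k}]_a=0$.
   Context: $\mathcal{M}_a^0(\mathfrak{g})=\mathfrak{g}$ and, for $k\ge1$, $\mathcal{M}_a^k(\mathfrak{g})$ is the space of skew symmetric $k$-linear maps $\mathfrak{g}^k\to\mathfrak{g}$. $\mathfrak{S}_{p,q}$ is the set of permutations $\sigma\in\mathfrak{S}_{p+q}$ with $\sigma(1)<\dots<\sigma(p)$ and $\sigma(p+1)<\dots<\sigma(p+q)$; $\varepsilon(\sigma)$ is the signature. For $F\in\mathcal{M}_a^{p+1}(\mathfrak{g})$, $G\in\mathcal{M}_a^{q+1}(\mathfrak{g})$, the bracket $[F,G]_a\in\mathcal{M}_a^{p+q+1}(\mathfrak{g})$ is $$[F,G]_a(X_1,\dots,X_{p+q+1})=(-1)^{pq}\sum_{\sigma\in\mathfrak{S}_{q+1,p}}\varepsilon(\sigma)F(G(X_{\sigma(1)},\dots,X_{\sigma(q+1)}),X_{\sigma(q+2)},\dots,X_{\sigma(p+q+1)})-\sum_{\sigma\in\mathfrak{S}_{p+1,q}}\varepsilon(\sigma)G(F(X_{\sigma(1)},\dots,X_{\sigma(p+1)}),X_{\sigma(p+2)},\dots,X_{\sigma(p+q+1)}).$$ A $2k$-Lie algebra structure on $\mathfrak{g}$ is an element $F\in\mathcal{M}_a^{2k}(\mathfrak{g})$ with $[F,F]_a=0$.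 Standard polynomials: for $k\ge1$, $\mathcal{A}_k(Y_1,\dots,Y_k)=\sum_{\sigma\in\mathfrak{S}_k}\varepsilon(\sigma)\,Y_{\sigma(1)}\cdots Y_{\sigma(k)}$ (product in $\mathfrak{g}$). *)

theory Defs
  imports Complex_Main "HOL-Combinatorics.Permutations"
begin

text \<open>
  The sort \<open>{ring, monoid_mult}\<close> is used instead of \<open>ring_1\<close> because the latter demands
  \<open>0 \<noteq> 1\<close> and would exclude the zero algebra.
\<close>

locale unital_complex_algebra = vector_space scale
  for scale :: "complex \<Rightarrow> 'a::{ring, monoid_mult} \<Rightarrow> 'a" +
  assumes mult_scale_left: "scale c x * y = scale c (x * y)"
    and mult_scale_right: "x * scale c y = scale c (x * y)"

text \<open>
  A map from the \<open>k\<close>-th power of \<open>'a\<close> to \<open>'a\<close> is represented by a function on sequences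
  \<open>X :: nat \<Rightarrow> 'a\<close> that depends only on \<open>X 1, \<dots>, X k\<close>. This representation is one-to-one, so
  equality of functions is equality of the represented maps; for \<open>k = 0\<close> one gets exactly the
  constant functions, that is, a copy of \<open>'a\<close>.
\<close>

definition skew_multilinear_maps ::
    "(complex \<Rightarrow> 'a::ab_group_add \<Rightarrow> 'a) \<Rightarrow> nat \<Rightarrow> ((nat \<Rightarrow> 'a) \<Rightarrow> 'a) set" where
  "skew_multilinear_maps scale k =
     {F. (\<forall>X Y. (\<forall>i\<in>{1..k}. X i = Y i) \<longrightarrow> F X = F Y) \<and>
         (\<forall>X. \<forall>i\<in>{1..k}. Vector_Spaces.linear scale scale (\<lambda>x. F (X(i := x)))) \<and>
         (\<forall>X \<sigma>. \<sigma> permutes {1..k} \<longrightarrow> F (\<lambda>i. X (\<sigma> i)) = scale (of_int (sign \<sigma>)) (F X))}"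

definition shuffle_perms :: "nat \<Rightarrow> nat \<Rightarrow> (nat \<Rightarrow> nat) set" where
  "shuffle_perms p q =
     {\<sigma>. \<sigma> permutes {1..p + q} \<and> strict_mono_on {1..p} \<sigma> \<and> strict_mono_on {p + 1..p + q} \<sigma>}"

text \<open>
  In \<open>insert_first q F G Y\<close>, with \<open>F\<close> of arity \<open>p + 1\<close> and \<open>G\<close> of arity \<open>q + 1\<close>, the value is
  \<open>F (G (Y 1, \<dots>, Y (q + 1)), Y (q + 2), \<dots>, Y (p + q + 1))\<close>: the argument of \<open>F\<close> at position
  \<open>i \<ge> 2\<close> is \<open>Y (q + i)\<close>.
\<close>

definition insert_first ::
    "nat \<Rightarrow> ((nat \<Rightarrow> 'a) \<Rightarrow> 'a) \<Rightarrow> ((nat \<Rightarrow> 'a) \<Rightarrow> 'a) \<Rightarrow> (nat \<Rightarrow> 'a) \<Rightarrow> 'a" where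
  "insert_first q F G Y = F (\<lambda>i. if i = 1 then G Y else Y (q + i))"

text \<open>
  The bracket of \<open>F\<close> of arity \<open>p + 1\<close> and \<open>G\<close> of arity \<open>q + 1\<close>. The arities are passed
  explicitly, since they are not determined by the functions.
\<close>

definition skew_bracket ::
    "(complex \<Rightarrow> 'a::ab_group_add \<Rightarrow> 'a) \<Rightarrow> nat \<Rightarrow> nat \<Rightarrow>
     ((nat \<Rightarrow> 'a) \<Rightarrow> 'a) \<Rightarrow> ((nat \<Rightarrow> 'a) \<Rightarrow> 'a) \<Rightarrow> (nat \<Rightarrow> 'a) \<Rightarrow> 'a" where
  "skew_bracket scale p q F G X =
     scale ((-1) ^ (p * q))
       (\<Sum>\<sigma>\<in>shuffle_perms (q + 1) p.
          scale (of_int (sign \<sigma>)) (insert_first q F G (\<lambda>i. X (\<sigma> i))))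
     - (\<Sum>\<sigma>\<in>shuffle_perms (p + 1) q.
          scale (of_int (sign \<sigma>)) (insert_first p G F (\<lambda>i. X (\<sigma> i))))"

definition even_Lie_structure ::
    "(complex \<Rightarrow> 'a::ab_group_add \<Rightarrow> 'a) \<Rightarrow> nat \<Rightarrow> ((nat \<Rightarrow> 'a) \<Rightarrow> 'a) \<Rightarrow> bool" where
  "even_Lie_structure scale k F \<longleftrightarrow>
     F \<in> skew_multilinear_maps scale (2 * k) \<and>
     skew_bracket scale (2 * k - 1) (2 * k - 1) F F = (\<lambda>_. 0)"

definition standard_polynomial ::
    "(complex \<Rightarrow> 'a::{ring, monoid_mult} \<Rightarrow> 'a) \<Rightarrow> nat \<Rightarrow> (nat \<Rightarrow> 'a) \<Rightarrow> 'a" where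
  "standard_polynomial scale k Y =
     (\<Sum>\<sigma> | \<sigma> permutes {1..k}.
        scale (of_int (sign \<sigma>)) (prod_list (map (\<lambda>i. Y (\<sigma> i)) [1..<k + 1])))"

end

theory Submission
  imports Defs "HOL-Library.Infinite_Set"
begin

text \<open>
  Write \<open>m = 2k\<close> and \<open>n = 2m - 1\<close>. The arities being even, the bracket is \<open>-2\<close> times a sum over
  shuffles of \<open>A\<^sub>m(A\<^sub>m(\<dots>), \<dots>)\<close>. Shuffles represent the cosets of the Young subgroup
  \<open>S\<^sub>m \<times> S\<^sub>m\<^sub>-\<^sub>1\<close>, so up to a nonzero integer factor this is the antisymmetrization over \<open>S\<^sub>n\<close>, in
  which the inner \<open>A\<^sub>m\<close> may be replaced by a multiple of the monomial \<open>B = X\<^sub>1 \<cdots> X\<^sub>m\<close>. Expanding the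
  outer \<open>A\<^sub>m\<close>, one groups the terms by the position \<open>j\<close> of \<open>B\<close>. Exchanging \<open>B\<close> with the next factor
  changes the sign in the outer \<open>A\<^sub>m\<close>, but is an even permutation of the \<open>n\<close> letters. Hence the
  contributions of \<open>j\<close> and \<open>j + 1\<close> are opposite, and the \<open>m\<close> contributions cancel in pairs.
\<close>

section \<open>Shuffles as coset representatives\<close>

text \<open>At a first point \<open>x\<close> of disagreement, the smaller of \<open>f x\<close> and
  \<open>g x\<close> is also taken by the other function, at some \<open>z < x\<close> by
  monotonicity. There both functions agree, so one of them would take the same value at
  \<open>z\<close> and at \<open>x\<close>.\<close>

lemma strict_mono_on_unique:
  fixes f g :: "'a::wellorder \<Rightarrow> 'b::linorder"
  assumes f: "strict_mono_on S f" and g: "strict_mono_on S g"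
    and im: "f ` S = g ` S" and "x \<in> S"
  shows "f x = g x"
  using \<open>x \<in> S\<close>
proof (induction x rule: less_induct)
  case (less x)
  show ?case
  proof (rule linorder_cases[of "f x" "g x"])
    assume lt: "f x < g x"
    obtain z where z: "z \<in> S" "f x = g z" using im less.prems by blast
    with lt less.prems have "z < x"
      using g by (metis linorder_less_linear order.asym strict_mono_onD)
    then show ?thesis using less z f by (metis order.irrefl strict_mono_onD)
  next
    assume lt: "g x < f x"
    obtain z where z: "z \<in> S" "g x = f z" using im less.prems by blast
    with lt less.prems have "z < x"
      using f by (metis linorder_less_linear order.asym strict_mono_onD)
    then show ?thesis using less z g by (metis order.irrefl strict_mono_onD)
  qed
qed

text \<open>The offset lets the same lemma sort values over both blocks of a shuffle:
  \<open>m = 0\<close> for the first block, \<open>m = p\<close> for the second.\<close>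

lemma ex_strict_mono_on_interval:
  fixes A :: "nat set"
  assumes "finite A"
  obtains h where "strict_mono_on {m + 1..m + card A} h" "bij_betw h {m + 1..m + card A} A"
proof -
  obtain g where g: "bij_betw g {..<card A} A" "strict_mono_on {..<card A} g"
    using ex_bij_betw_strict_mono_card[OF assms] by blast
  have shift: "bij_betw (\<lambda>i. i - (m + 1)) {m + 1..m + card A} {..<card A}"
    by (rule bij_betw_byWitness[where f' = "\<lambda>i. i + (m + 1)"]) auto
  show thesis
  proof
    show "bij_betw (\<lambda>i. g (i - (m + 1))) {m + 1..m + card A} A"
      using bij_betw_trans[OF shift g(1)] by (simp add: comp_def)
    show "strict_mono_on {m + 1..m + card A} (\<lambda>i. g (i - (m + 1)))"
    proof (rule strict_mono_onI)
      fix r s assume "r \<in> {m + 1..m + card A}" "s \<in> {m + 1..m + card A}" "r < s"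
      then show "g (r - (m + 1)) < g (s - (m + 1))"
        by (intro strict_mono_onD[OF g(2)]) auto
    qed
  qed
qed

text \<open>The Young subgroup of the symmetric group on \<open>p + q\<close> letters, isomorphic to
  the product of the symmetric groups of the two blocks.\<close>

definition young_perms :: "nat \<Rightarrow> nat \<Rightarrow> (nat \<Rightarrow> nat) set" where
  "young_perms p q = {a \<circ> b |a b. a permutes {1..p} \<and> b permutes {p + 1..p + q}}"

lemma young_perms_permutes: "\<alpha> \<in> young_perms p q \<Longrightarrow> \<alpha> permutes {1..p + q}"
  unfolding young_perms_def
  by (auto intro!: permutes_compose elim: permutes_subset)

lemma young_perms_image:
  assumes "\<alpha> \<in> young_perms p q"
  shows "\<alpha> ` {1..p} = {1..p}" "\<alpha> ` {p + 1..p + q} = {p + 1..p + q}"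
proof -
  obtain a b where \<alpha>: "\<alpha> = a \<circ> b" and a: "a permutes {1..p}" and b: "b permutes {p + 1..p + q}"
    using assms unfolding young_perms_def by blast
  have "b ` {1..p} = {1..p}" using permutes_not_in[OF b] by (auto simp: image_iff)
  then show "\<alpha> ` {1..p} = {1..p}" unfolding \<alpha> image_comp[symmetric] using permutes_image[OF a] by simp
  have "a ` {p + 1..p + q} = {p + 1..p + q}" using permutes_not_in[OF a] by (auto simp: image_iff)
  then show "\<alpha> ` {p + 1..p + q} = {p + 1..p + q}"
    unfolding \<alpha> image_comp[symmetric] permutes_image[OF b] .
qed

lemma finite_young_perms: "finite (young_perms p q)"
proof (rule finite_subset)
  show "young_perms p q \<subseteq> {\<alpha>. \<alpha> permutes {1..p + q}}" using young_perms_permutes by blast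
qed (simp add: finite_permutations)

lemma id_in_young_perms: "id \<in> young_perms p q"
  unfolding young_perms_def using permutes_id by (metis (mono_tags, lifting) comp_id mem_Collect_eq)

text \<open>A bijection preserving the first block also preserves its complement, so it is the
  product of its restrictions to the two blocks.\<close>

lemma young_permsI:
  assumes \<alpha>: "\<alpha> permutes {1..p + q}" and im: "\<alpha> ` {1..p} = {1..p}"
  shows "\<alpha> \<in> young_perms p q"
proof -
  let ?a = "restrict_id \<alpha> {1..p}" and ?b = "restrict_id \<alpha> {p + 1..p + q}"
  have inj: "inj \<alpha>" by (rule permutes_inj[OF \<alpha>])
  have "{p + 1..p + q} = {1..p + q} - {1..p}" by auto
  then have im': "\<alpha> ` {p + 1..p + q} = {p + 1..p + q}"
    using image_set_diff[OF inj] permutes_image[OF \<alpha>] im by metis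
  have a: "?a permutes {1..p}"
    by (rule permutes_restrict_id) (use im inj in \<open>auto simp: bij_betw_def intro: inj_on_subset\<close>)
  have b: "?b permutes {p + 1..p + q}"
    by (rule permutes_restrict_id) (use im' inj in \<open>auto simp: bij_betw_def intro: inj_on_subset\<close>)
  have "\<alpha> x = (?a \<circ> ?b) x" for x
  proof -
    consider "x \<in> {1..p}" | "x \<in> {p + 1..p + q}" | "x \<notin> {1..p + q}" by fastforce
    then show ?thesis
    proof cases
      case 2
      then have "\<alpha> x \<in> {p + 1..p + q}" using im' by blast
      with 2 show ?thesis by simp
    next
      case 3
      then show ?thesis using permutes_not_in[OF \<alpha> 3] by auto
    qed auto
  qed
  then show ?thesis unfolding young_perms_def using a b by blast
qed

text \<open>A left coset of the Young subgroup is determined by the image of the first block. Its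
  only shuffle enumerates the images of both blocks in increasing order.\<close>

lemma shuffle_young_bij:
  "bij_betw (\<lambda>(\<sigma>, \<alpha>). \<sigma> \<circ> \<alpha>) (shuffle_perms p q \<times> young_perms p q) {\<pi>. \<pi> permutes {1..p + q}}"
  unfolding bij_betw_def
proof
  show "inj_on (\<lambda>(\<sigma>, \<alpha>). \<sigma> \<circ> \<alpha>) (shuffle_perms p q \<times> young_perms p q)"
  proof (rule inj_onI, clarify)
    fix \<sigma> \<alpha> \<sigma>' \<alpha>'
    assume \<sigma>: "\<sigma> \<in> shuffle_perms p q" and \<sigma>': "\<sigma>' \<in> shuffle_perms p q"
      and \<alpha>: "\<alpha> \<in> young_perms p q" and \<alpha>': "\<alpha>' \<in> young_perms p q"
      and eq: "\<sigma> \<circ> \<alpha> = \<sigma>' \<circ> \<alpha>'"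
    have "\<sigma> ` {1..p} = \<sigma>' ` {1..p}"
      using young_perms_image(1)[OF \<alpha>] young_perms_image(1)[OF \<alpha>'] eq by (metis image_comp)
    moreover have "\<sigma> ` {p + 1..p + q} = \<sigma>' ` {p + 1..p + q}"
      using young_perms_image(2)[OF \<alpha>] young_perms_image(2)[OF \<alpha>'] eq by (metis image_comp)
    ultimately have "\<sigma> x = \<sigma>' x" if "x \<in> {1..p + q}" for x
      using that \<sigma> \<sigma>' strict_mono_on_unique[of "{1..p}" \<sigma> \<sigma>' x]
        strict_mono_on_unique[of "{p + 1..p + q}" \<sigma> \<sigma>' x]
      unfolding shuffle_perms_def by fastforce
    moreover have "\<sigma> x = \<sigma>' x" if "x \<notin> {1..p + q}" for x
      using that \<sigma> \<sigma>' permutes_not_in[of \<sigma> "{1..p + q}" x] permutes_not_in[of \<sigma>' "{1..p + q}" x]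
      unfolding shuffle_perms_def by simp
    ultimately have "\<sigma> = \<sigma>'" by blast
    moreover have "inj \<sigma>" using \<sigma> unfolding shuffle_perms_def by (auto intro: permutes_inj)
    ultimately have "\<alpha> = \<alpha>'" using eq by (metis comp_apply ext injD)
    with \<open>\<sigma> = \<sigma>'\<close> show "\<sigma> = \<sigma>' \<and> \<alpha> = \<alpha>'" ..
  qed
  show "(\<lambda>(\<sigma>, \<alpha>). \<sigma> \<circ> \<alpha>) ` (shuffle_perms p q \<times> young_perms p q) = {\<pi>. \<pi> permutes {1..p + q}}"
  proof (intro equalityI subsetI)
    fix \<pi> assume "\<pi> \<in> (\<lambda>(\<sigma>, \<alpha>). \<sigma> \<circ> \<alpha>) ` (shuffle_perms p q \<times> young_perms p q)"
    then show "\<pi> \<in> {\<pi>. \<pi> permutes {1..p + q}}"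
      by (clarify, intro permutes_compose) (simp_all add: young_perms_permutes shuffle_perms_def del: One_nat_def)
  next
    fix \<pi> assume "\<pi> \<in> {\<pi>. \<pi> permutes {1..p + q}}"
    then have \<pi>: "\<pi> permutes {1..p + q}" by simp
    have inj: "inj \<pi>" by (rule permutes_inj[OF \<pi>])
    have cA: "card (\<pi> ` {1..p}) = p" and cB: "card (\<pi> ` {p + 1..p + q}) = q"
      by (simp_all add: card_image inj_on_subset[OF inj])
    obtain h1 where h1: "strict_mono_on {1..p} h1" "bij_betw h1 {1..p} (\<pi> ` {1..p})"
      using ex_strict_mono_on_interval[of "\<pi> ` {1..p}" 0] cA by auto
    obtain h2 where h2: "strict_mono_on {p + 1..p + q} h2"
      "bij_betw h2 {p + 1..p + q} (\<pi> ` {p + 1..p + q})"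
      using ex_strict_mono_on_interval[of "\<pi> ` {p + 1..p + q}" p] cB by auto
    \<comment> \<open>The shuffle in the coset of \<pi>: the values of \<pi> are sorted within each
      block.\<close>
    define \<sigma> where "\<sigma> i = (if i \<in> {1..p} then h1 i else if i \<in> {p + 1..p + q} then h2 i else i)" for i
    have b1: "bij_betw \<sigma> {1..p} (\<pi> ` {1..p})"
      using h1(2) by (rule bij_betw_cong[THEN iffD1, rotated]) (auto simp: \<sigma>_def)
    have b2: "bij_betw \<sigma> {p + 1..p + q} (\<pi> ` {p + 1..p + q})"
      using h2(2) by (rule bij_betw_cong[THEN iffD1, rotated]) (auto simp: \<sigma>_def)
    have un: "{1..p} \<union> {p + 1..p + q} = {1..p + q}" by auto
    have "\<pi> ` {1..p} \<inter> \<pi> ` {p + 1..p + q} = {}"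
      unfolding image_Int[OF inj, symmetric] by simp
    from bij_betw_combine[OF b1 b2 this] have "bij_betw \<sigma> {1..p + q} {1..p + q}"
      unfolding image_Un[symmetric] un permutes_image[OF \<pi>] .
    then have \<sigma>: "\<sigma> permutes {1..p + q}"
      by (rule bij_imp_permutes) (auto simp: \<sigma>_def)
    have "strict_mono_on {1..p} \<sigma>"
      using h1(1) by (auto simp: \<sigma>_def strict_mono_on_def)
    moreover have "strict_mono_on {p + 1..p + q} \<sigma>"
      using h2(1) by (auto simp: \<sigma>_def strict_mono_on_def)
    ultimately have sh: "\<sigma> \<in> shuffle_perms p q" using \<sigma> unfolding shuffle_perms_def by blast
    have "inv \<sigma> \<circ> \<pi> permutes {1..p + q}" by (intro permutes_compose \<pi> permutes_inv \<sigma>)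
    moreover have "(inv \<sigma> \<circ> \<pi>) ` {1..p} = {1..p}"
      using bij_betw_imp_surj_on[OF b1] permutes_inj[OF \<sigma>]
      by (metis image_comp image_inv_f_f)
    ultimately have "inv \<sigma> \<circ> \<pi> \<in> young_perms p q" by (rule young_permsI)
    moreover have "\<pi> = \<sigma> \<circ> (inv \<sigma> \<circ> \<pi>)"
      using permutes_inv_o(1)[OF \<sigma>] by (simp add: o_assoc)
    ultimately show "\<pi> \<in> (\<lambda>(\<sigma>, \<alpha>). \<sigma> \<circ> \<alpha>) ` (shuffle_perms p q \<times> young_perms p q)"
      using sh by (intro image_eqI[where x = "(\<sigma>, inv \<sigma> \<circ> \<pi>)"]) auto
  qed
qed

text \<open>\<open>T\<close> is constant on cosets. The outer sum on the right is constant in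
  \<alpha> and only records the size of a coset.\<close>

lemma sum_permutations_shuffle:
  assumes "\<And>\<sigma> \<alpha>. \<sigma> permutes {1..p + q} \<Longrightarrow> \<alpha> \<in> young_perms p q \<Longrightarrow> T (\<sigma> \<circ> \<alpha>) = T \<sigma>"
  shows "(\<Sum>\<pi> | \<pi> permutes {1..p + q}. T \<pi>) =
    (\<Sum>\<alpha>\<in>young_perms p q. \<Sum>\<sigma>\<in>shuffle_perms p q. T \<sigma>)"
proof -
  have "(\<Sum>\<pi> | \<pi> permutes {1..p + q}. T \<pi>) =
      (\<Sum>(\<sigma>, \<alpha>)\<in>shuffle_perms p q \<times> young_perms p q. T (\<sigma> \<circ> \<alpha>))"
    using sum.reindex_bij_betw[OF shuffle_young_bij, of T p q] by (simp only: case_prod_unfold)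
  also have "\<dots> = (\<Sum>(\<sigma>, \<alpha>)\<in>shuffle_perms p q \<times> young_perms p q. T \<sigma>)"
    by (rule sum.cong) (auto simp: shuffle_perms_def assms)
  also have "\<dots> = (\<Sum>\<sigma>\<in>shuffle_perms p q. \<Sum>\<alpha>\<in>young_perms p q. T \<sigma>)"
    by (simp add: sum.cartesian_product)
  also have "\<dots> = (\<Sum>\<alpha>\<in>young_perms p q. \<Sum>\<sigma>\<in>shuffle_perms p q. T \<sigma>)"
    by (rule sum.swap)
  finally show ?thesis .
qed

section \<open>Cycles\<close>

text \<open>For \<open>0 < m < y\<close> this is the cycle 1, 2, ..., m, y of length
  \<open>m + 1\<close>. Building it from \<open>m\<close> transpositions makes its sign
  immediate.\<close>

fun cyc :: "nat \<Rightarrow> nat \<Rightarrow> nat \<Rightarrow> nat" where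
  "cyc 0 y = id"
| "cyc (Suc m) y = transpose (Suc m) y \<circ> cyc m y"

text \<open>The index 0 needs its own case: letters are numbered from 1, and \<open>i < m\<close>
  would otherwise catch it.\<close>

lemma cyc_apply:
  assumes "m < y"
  shows "cyc m y i = (if i = 0 then 0 else if i < m then Suc i else if i = m then y
    else if i = y \<and> 0 < m then 1 else i)"
  using assms by (induction m arbitrary: i) (auto simp: transpose_def)

lemma cyc_permutes: "m < y \<Longrightarrow> y \<le> n \<Longrightarrow> cyc m y permutes {1..n}"
  by (induction m) (auto intro!: permutes_compose permutes_swap_id simp: permutes_id)

lemma sign_cyc: "m < y \<Longrightarrow> sign (cyc m y) = (-1) ^ m"
proof (induction m)
  case (Suc m)
  have "permutation (cyc m y)"
    using cyc_permutes[of m y y] Suc.prems by (intro permutes_imp_permutation[of "{1..y}"]) auto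
  then show ?case
    using Suc sign_compose[OF permutation_swap_id[of "Suc m" y], of "cyc m y"]
    by (simp only: cyc.simps) (simp add: sign_swap_id)
qed simp

declare cyc.simps [simp del]

section \<open>Antisymmetrization\<close>

context unital_complex_algebra
begin

abbreviation sgnscale :: "(nat \<Rightarrow> nat) \<Rightarrow> 'a \<Rightarrow> 'a" where
  "sgnscale \<sigma> x \<equiv> scale (of_int (sign \<sigma>)) x"

lemma sgnscale_compose:
  assumes "\<sigma> permutes {1..n::nat}" "\<rho> permutes {1..n}"
  shows "sgnscale (\<sigma> \<circ> \<rho>) x = sgnscale \<sigma> (sgnscale \<rho> x)"
  using assms by (simp add: sign_compose permutes_imp_permutation[of "{1..n}"])

lemma sgnscale_idem [simp]: "sgnscale \<sigma> (sgnscale \<sigma> x) = x"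
  by (cases \<sigma> rule: sign_cases) simp_all

lemma sgnscale_commute: "sgnscale \<sigma> (sgnscale \<rho> x) = sgnscale \<rho> (sgnscale \<sigma> x)"
  by (rule scale_left_commute)

text \<open>Antisymmetrization without the factor 1/n!.\<close>

definition alt :: "nat \<Rightarrow> ((nat \<Rightarrow> 'a) \<Rightarrow> 'a) \<Rightarrow> (nat \<Rightarrow> 'a) \<Rightarrow> 'a" where
  "alt n f X = (\<Sum>\<pi> | \<pi> permutes {1..n}. sgnscale \<pi> (f (\<lambda>i. X (\<pi> i))))"

definition word :: "nat \<Rightarrow> (nat \<Rightarrow> 'a) \<Rightarrow> 'a" where
  "word n X = prod_list (map X [1..<n + 1])"

lemma standard_polynomial_alt: "standard_polynomial scale n = alt n (word n)"
  by (simp add: fun_eq_iff standard_polynomial_def alt_def word_def)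

text \<open>Left translation \<pi> to \<open>\<rho> \<circ> \<pi>\<close> of the summation index.
  This gives skew symmetry.\<close>

lemma alt_permute_argument:
  assumes "\<rho> permutes {1..n}"
  shows "alt n f (\<lambda>i. X (\<rho> i)) = sgnscale \<rho> (alt n f X)"
proof -
  have "sgnscale \<rho> (alt n f X) =
      sgnscale \<rho> (\<Sum>\<pi> | \<pi> permutes {1..n}. sgnscale (\<rho> \<circ> \<pi>) (f (\<lambda>i. X ((\<rho> \<circ> \<pi>) i))))"
    unfolding alt_def by (subst setum_permutations_compose_left[OF assms]) simp
  also have "\<dots> = alt n f (\<lambda>i. X (\<rho> i))"
    unfolding alt_def scale_sum_right
    by (intro sum.cong refl) (simp only: sgnscale_compose[OF assms] sgnscale_idem comp_apply mem_Collect_eq)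
  finally show ?thesis by simp
qed

text \<open>Right translation \<pi> to \<open>\<pi> \<circ> \<rho>\<close>. Rearranging the letters
  of an expression under \<open>alt\<close> therefore costs only a sign, which is what lets
  different monomials be compared.\<close>

lemma alt_permute_function:
  assumes "\<rho> permutes {1..n}"
  shows "alt n (\<lambda>X. f (\<lambda>i. X (\<rho> i))) X = sgnscale \<rho> (alt n f X)"
proof -
  have "sgnscale \<rho> (alt n f X) =
      sgnscale \<rho> (\<Sum>\<pi> | \<pi> permutes {1..n}. sgnscale (\<pi> \<circ> \<rho>) (f (\<lambda>i. X ((\<pi> \<circ> \<rho>) i))))"
    unfolding alt_def by (subst sum_permutations_compose_right[OF assms]) simp
  also have "\<dots> = alt n (\<lambda>X. f (\<lambda>i. X (\<rho> i))) X"
    unfolding alt_def scale_sum_right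
    by (intro sum.cong refl)
      (simp only: sgnscale_compose[OF _ assms] sgnscale_commute[of _ \<rho>] sgnscale_idem comp_apply mem_Collect_eq)
  finally show ?thesis by simp
qed

lemma alt_sum:
  "alt n (\<lambda>X. \<Sum>a\<in>S. sgnscale a (f a X)) X = (\<Sum>a\<in>S. sgnscale a (alt n (f a) X))"
proof -
  have "alt n (\<lambda>X. \<Sum>a\<in>S. sgnscale a (f a X)) X =
      (\<Sum>\<pi> | \<pi> permutes {1..n}. \<Sum>a\<in>S. sgnscale a (sgnscale \<pi> (f a (\<lambda>i. X (\<pi> i)))))"
    unfolding alt_def by (simp only: scale_sum_right sgnscale_commute)
  also have "\<dots> = (\<Sum>a\<in>S. sgnscale a (alt n (f a) X))"
    unfolding alt_def by (subst sum.swap) (simp only: scale_sum_right)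
  finally show ?thesis .
qed

text \<open>Since \<open>U\<close> and \<open>V\<close> ignore permutations of the first
  \<open>m\<close> letters, each term of the inner \<open>alt\<close> is the whole product
  \<open>U * f * V\<close> with letters permuted by \<open>a\<close>. The outer \<open>alt\<close>
  turns this into a second factor \<open>sign a\<close>, and the two signs cancel.\<close>

lemma alt_absorb:
  assumes "m \<le> n"
    and U: "\<And>a X. a permutes {1..m} \<Longrightarrow> U (\<lambda>i. X (a i)) = U X"
    and V: "\<And>a X. a permutes {1..m} \<Longrightarrow> V (\<lambda>i. X (a i)) = V X"
  shows "alt n (\<lambda>X. U X * alt m f X * V X) X =
    (\<Sum>a | a permutes {1..m}. alt n (\<lambda>X. U X * f X * V X) X)"
proof -
  have eq: "U Y * alt m f Y * V Y = (\<Sum>a | a permutes {1..m}.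
      sgnscale a (U (\<lambda>i. Y (a i)) * f (\<lambda>i. Y (a i)) * V (\<lambda>i. Y (a i))))" for Y
    unfolding alt_def sum_distrib_left sum_distrib_right
    by (rule sum.cong) (simp_all add: U V mult_scale_left mult_scale_right)
  have "alt n (\<lambda>X. U X * alt m f X * V X) X = (\<Sum>a | a permutes {1..m}.
      sgnscale a (alt n (\<lambda>X. U (\<lambda>i. X (a i)) * f (\<lambda>i. X (a i)) * V (\<lambda>i. X (a i))) X))"
    unfolding eq by (rule alt_sum)
  also have "\<dots> = (\<Sum>a | a permutes {1..m}. alt n (\<lambda>X. U X * f X * V X) X)"
  proof (rule sum.cong)
    fix a assume "a \<in> {a. a permutes {1..m}}"
    then have "a permutes {1..n}" using assms(1) by (auto elim: permutes_subset)
    from alt_permute_function[OF this, of "\<lambda>X. U X * f X * V X"]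
    show "sgnscale a (alt n (\<lambda>X. U (\<lambda>i. X (a i)) * f (\<lambda>i. X (a i)) * V (\<lambda>i. X (a i))) X) =
        alt n (\<lambda>X. U X * f X * V X) X"
      by (simp del: scale_scale)
  qed simp
  finally show ?thesis .
qed

section \<open>Standard polynomials are skew multilinear\<close>

lemma word_cong: "(\<And>i. i \<in> {1..n} \<Longrightarrow> X i = Y i) \<Longrightarrow> word n X = word n Y"
  unfolding word_def by (rule arg_cong[of _ _ prod_list]) auto

lemma word_split:
  assumes "j \<in> {1..n}"
  shows "word n X = prod_list (map X [1..<j]) * X j * prod_list (map X [j + 1..<n + 1])"
proof -
  have "[1..<n + 1] = [1..<j] @ j # [j + 1..<n + 1]"
    using assms upt_add_eq_append[of 1 j "n + 1 - j"] upt_conv_Cons[of j "n + 1"] by simp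
  then show ?thesis by (simp only: word_def) (simp add: mult.assoc)
qed

lemma alt_word_cong: "(\<And>i. i \<in> {1..n} \<Longrightarrow> X i = Y i) \<Longrightarrow> alt n (word n) X = alt n (word n) Y"
  unfolding alt_def
  by (intro sum.cong refl arg_cong2[of _ _ _ _ scale] word_cong)
    (auto simp del: atLeastAtMost_iff simp: permutes_in_image)

lemma linear_sgnscale: "Vector_Spaces.linear scale scale f \<Longrightarrow> Vector_Spaces.linear scale scale (\<lambda>x. sgnscale \<sigma> (f x))"
  by (simp add: Vector_Spaces.linear_iff scale_right_distrib scale_left_commute)

lemma linear_mult: "Vector_Spaces.linear scale scale (\<lambda>x. a * x * b)"
  by (simp add: Vector_Spaces.linear_iff vector_space_axioms distrib_left distrib_right mult_scale_left
      mult_scale_right)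

lemma linear_sum:
  assumes "\<And>a. a \<in> S \<Longrightarrow> Vector_Spaces.linear scale scale (f a)"
  shows "Vector_Spaces.linear scale scale (\<lambda>x. \<Sum>a\<in>S. f a x)"
  using assms
  by (simp add: Vector_Spaces.linear_iff vector_space_axioms sum.distrib scale_sum_right)

text \<open>Each monomial contains the letter \<open>X i\<close> exactly once, at position
  \<open>inv \<pi> i\<close>, so it has the form \<open>u * x * v\<close>.\<close>

lemma linear_alt_word:
  assumes "i \<in> {1..n}"
  shows "Vector_Spaces.linear scale scale (\<lambda>x. alt n (word n) (X(i := x)))"
  unfolding alt_def
proof (intro linear_sum linear_sgnscale)
  fix \<pi> assume "\<pi> \<in> {\<pi>. \<pi> permutes {1..n}}"
  then have \<pi>: "\<pi> permutes {1..n}" by simp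
  define j where "j = inv \<pi> i"
  have j: "j \<in> {1..n}" "\<pi> j = i"
    using assms permutes_in_image[OF permutes_inv[OF \<pi>]] permutes_inverses(1)[OF \<pi>]
    by (simp_all add: j_def)
  have ne: "\<pi> l \<noteq> i" if "l \<noteq> j" for l
    using that j(2) permutes_inj[OF \<pi>] by (auto dest: injD)
  have "word n (\<lambda>l. (X(i := x)) (\<pi> l)) =
      prod_list (map (\<lambda>l. X (\<pi> l)) [1..<j]) * x * prod_list (map (\<lambda>l. X (\<pi> l)) [j + 1..<n + 1])" for x
  proof -
    have "map (\<lambda>l. (X(i := x)) (\<pi> l)) [1..<j] = map (\<lambda>l. X (\<pi> l)) [1..<j]"
      "map (\<lambda>l. (X(i := x)) (\<pi> l)) [j + 1..<n + 1] = map (\<lambda>l. X (\<pi> l)) [j + 1..<n + 1]"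
      using ne by (auto simp del: upt_Suc)
    then show ?thesis unfolding word_split[OF j(1)] by (simp only: j(2) fun_upd_same)
  qed
  then show "Vector_Spaces.linear scale scale (\<lambda>x. word n (\<lambda>l. (X(i := x)) (\<pi> l)))"
    by (simp only: linear_mult)
qed

lemma alt_word_skew_multilinear: "alt n (word n) \<in> skew_multilinear_maps scale n"
  unfolding skew_multilinear_maps_def
  using alt_word_cong linear_alt_word alt_permute_argument by blast

section \<open>The bracket of a standard polynomial with itself\<close>

text \<open>The factor \<open>a\<close> permutes the arguments of the inner \<open>A\<close>, and
  \<open>b\<close> permutes the arguments of the outer \<open>A\<close> after the first. Each
  produces its sign by skew symmetry, which cancels the sign in \<open>T\<close>.\<close>

lemma insert_first_young:
  fixes X :: "nat \<Rightarrow> 'a"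
  assumes \<sigma>: "\<sigma> permutes {1..(q + 1) + q}" and \<alpha>: "\<alpha> \<in> young_perms (q + 1) q"
  defines "A \<equiv> alt (q + 1) (word (q + 1))"
  defines "T \<equiv> \<lambda>\<sigma>. sgnscale \<sigma> (insert_first q A A (\<lambda>i. X (\<sigma> i)))"
  shows "T (\<sigma> \<circ> \<alpha>) = T \<sigma>"
proof -
  let ?n = "(q + 1) + q"
  obtain a b where ab: "\<alpha> = a \<circ> b" and a: "a permutes {1..q + 1}" and b: "b permutes {q + 1 + 1..?n}"
    using \<alpha> unfolding young_perms_def by blast
  have a': "a permutes {1..?n}" using a by (rule permutes_subset) auto
  have b': "b permutes {1..?n}" using b by (rule permutes_subset) auto
  have Ta: "T (\<sigma> \<circ> a) = T \<sigma>" if \<sigma>: "\<sigma> permutes {1..?n}" for \<sigma>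
  proof -
    let ?Z = "\<lambda>i. X (\<sigma> (q + i))"
    have inner: "A (\<lambda>i. X (\<sigma> (a i))) = sgnscale a (A (\<lambda>i. X (\<sigma> i)))"
      unfolding A_def by (rule alt_permute_argument[OF a])
    have "insert_first q A A (\<lambda>i. X ((\<sigma> \<circ> a) i)) = A (?Z(1 := sgnscale a (A (\<lambda>i. X (\<sigma> i)))))"
      unfolding insert_first_def comp_apply inner unfolding A_def
      by (rule alt_word_cong) (use permutes_not_in[OF a] in auto)
    \<comment> \<open>The sign leaves the inner value by linearity of the outer \<open>A\<close> in
      its first slot.\<close>
    also have "\<dots> = sgnscale a (A (?Z(1 := A (\<lambda>i. X (\<sigma> i)))))"
      using linear_alt_word[of 1 "q + 1" ?Z] unfolding A_def Vector_Spaces.linear_iff by auto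
    also have "A (?Z(1 := A (\<lambda>i. X (\<sigma> i)))) = insert_first q A A (\<lambda>i. X (\<sigma> i))"
      unfolding insert_first_def by (rule arg_cong[of _ _ A]) auto
    finally show ?thesis
      unfolding T_def by (simp add: sgnscale_compose[OF \<sigma> a'] del: scale_scale)
  qed
  have Tb: "T (\<sigma> \<circ> b) = T \<sigma>"
  proof -
    \<comment> \<open>Letter \<open>q + i\<close> sits in slot \<open>i\<close> of the outer
      \<open>A\<close>, so \<open>c\<close> is \<open>b\<close> read on the slots 2 to
      \<open>q + 1\<close>, with the same sign.\<close>
    define c where "c = map_permutation {q + 1 + 1..?n} (\<lambda>i. i - q) b"
    have inj: "inj_on (\<lambda>i. i - q) {q + 1 + 1..?n}" by (rule inj_onI) auto
    have bij: "bij_betw (\<lambda>i. i - q) {q + 1 + 1..?n} {2..q + 1}"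
      by (rule bij_betw_byWitness[where f' = "\<lambda>i. i + q"]) auto
    have c2: "c permutes {2..q + 1}"
      unfolding c_def by (rule map_permutation_permutes[OF bij b])
    then have c: "c permutes {1..q + 1}" by (rule permutes_subset) auto
    have sc: "sign c = sign b"
      unfolding c_def by (rule sign_map_permutation[OF inj b]) simp
    have capp: "q + c i = b (q + i)" "c i \<noteq> 1" if "i \<in> {2..q + 1}" for i
    proof -
      have mem: "q + i \<in> {q + 1 + 1..?n}" using that by auto
      have "c (q + i - q) = b (q + i) - q"
        unfolding c_def by (rule map_permutation_apply[OF inj mem])
      moreover have "b (q + i) \<in> {q + 1 + 1..?n}" using permutes_in_image[OF b] mem by blast
      ultimately show "q + c i = b (q + i)" "c i \<noteq> 1" by auto
    qed
    have c1: "c 1 = 1" by (rule permutes_not_in[OF c2]) simp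
    let ?Z = "\<lambda>i. if i = 1 then A (\<lambda>i. X (\<sigma> i)) else X (\<sigma> (q + i))"
    have inner: "A (\<lambda>i. X (\<sigma> (b i))) = A (\<lambda>i. X (\<sigma> i))"
      unfolding A_def by (rule alt_word_cong) (use permutes_not_in[OF b] in auto)
    have "insert_first q A A (\<lambda>i. X ((\<sigma> \<circ> b) i)) = A (\<lambda>i. ?Z (c i))"
      unfolding insert_first_def comp_apply inner
    proof (unfold A_def, rule alt_word_cong, fold A_def)
      fix i assume i: "i \<in> {1..q + 1}"
      show "(if i = 1 then A (\<lambda>i. X (\<sigma> i)) else X (\<sigma> (b (q + i)))) = ?Z (c i)"
        using i c1 capp[of i] by (cases "i = 1") auto
    qed
    also have "\<dots> = sgnscale c (insert_first q A A (\<lambda>i. X (\<sigma> i)))"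
      unfolding insert_first_def using alt_permute_argument[OF c, of _ ?Z] unfolding A_def .
    finally show ?thesis
      unfolding T_def by (simp add: sgnscale_compose[OF \<sigma> b'] sc del: scale_scale)
  qed
  \<comment> \<open>\<open>Ta\<close> is available for every permutation but \<open>Tb\<close> only
    for \<sigma>, so \<open>a\<close> must be removed first. The factors commute, their supports
    being disjoint.\<close>
  have "T (\<sigma> \<circ> \<alpha>) = T (\<sigma> \<circ> b \<circ> a)"
  proof -
    have "a \<circ> b = b \<circ> a"
    proof
      fix x
      have 1: "x \<in> {1..q + 1} \<Longrightarrow> a x \<in> {1..q + 1}" using permutes_in_image[OF a] by blast
      have 2: "x \<in> {q + 1 + 1..?n} \<Longrightarrow> b x \<in> {q + 1 + 1..?n}" using permutes_in_image[OF b] by blast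
      show "(a \<circ> b) x = (b \<circ> a) x"
        using 1 2 permutes_not_in[OF a, of x] permutes_not_in[OF b, of x]
          permutes_not_in[OF a, of "b x"] permutes_not_in[OF b, of "a x"]
        by (cases "x \<in> {1..q + 1}"; cases "x \<in> {q + 1 + 1..?n}") auto
    qed
    then show ?thesis by (simp add: ab o_assoc)
  qed
  also have "\<dots> = T \<sigma>" using Ta[OF permutes_compose[OF b' \<sigma>]] Tb by simp
  finally show ?thesis .
qed

section \<open>Monomials containing an inner block\<close>

text \<open>The \<tau>-monomial of the outer standard polynomial in \<open>insert_first\<close>. The
  block \<open>B\<close> is a parameter because it is first the inner standard polynomial and later
  a single word.\<close>

definition nested_word :: "nat \<Rightarrow> ((nat \<Rightarrow> 'a) \<Rightarrow> 'a) \<Rightarrow> (nat \<Rightarrow> nat) \<Rightarrow> (nat \<Rightarrow> 'a) \<Rightarrow> 'a" where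
  "nested_word q B \<tau> X = word (q + 1) (\<lambda>i. if \<tau> i = 1 then B X else X (q + \<tau> i))"

lemma nested_word_split:
  assumes \<tau>: "\<tau> permutes {1..q + 1}" and j: "j \<in> {1..q + 1}" "\<tau> j = 1"
  shows "nested_word q B \<tau> X = prod_list (map (\<lambda>i. X (q + \<tau> i)) [1..<j]) * B X *
    prod_list (map (\<lambda>i. X (q + \<tau> i)) [j + 1..<q + 1 + 1])"
proof -
  have ne: "\<tau> l \<noteq> 1" if "l \<noteq> j" for l
    using that j(2) permutes_inj[OF \<tau>] by (metis injD)
  have "map (\<lambda>i. if \<tau> i = 1 then B X else X (q + \<tau> i)) [1..<j] = map (\<lambda>i. X (q + \<tau> i)) [1..<j]"
    "map (\<lambda>i. if \<tau> i = 1 then B X else X (q + \<tau> i)) [j + 1..<q + 1 + 1] =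
      map (\<lambda>i. X (q + \<tau> i)) [j + 1..<q + 1 + 1]"
    using ne by (auto simp del: upt_Suc)
  then show ?thesis
    unfolding nested_word_def word_split[OF j(1)] by (simp only: j(2) if_True refl)
qed

text \<open>The factors on either side of the block use only letters beyond \<open>q + 1\<close>.
  They are invariant under permutations of the inner letters, so \<open>alt_absorb\<close>
  applies.\<close>

lemma alt_nested_word:
  assumes \<tau>: "\<tau> permutes {1..q + 1}" and "q + 1 \<le> n"
  shows "alt n (nested_word q (alt (q + 1) f) \<tau>) X =
    (\<Sum>a | a permutes {1..q + 1}. alt n (nested_word q f \<tau>) X)"
proof -
  define j where "j = inv \<tau> 1"
  have j: "j \<in> {1..q + 1}" "\<tau> j = 1"
    using permutes_in_image[OF permutes_inv[OF \<tau>]] permutes_inverses(1)[OF \<tau>]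
    by (simp_all add: j_def)
  have gt: "q + \<tau> l \<notin> {1..q + 1}" if "l \<in> {1..q + 1}" "l \<noteq> j" for l
  proof -
    have "\<tau> l \<noteq> 1" using that j(2) permutes_inj[OF \<tau>] by (metis injD)
    moreover have "\<tau> l \<in> {1..q + 1}" using that permutes_in_image[OF \<tau>] by blast
    ultimately show ?thesis by auto
  qed
  have map_fix: "prod_list (map (\<lambda>i. Y (a (q + \<tau> i))) L) = prod_list (map (\<lambda>i. Y (q + \<tau> i)) L)"
    if "a permutes {1..q + 1}" "set L \<subseteq> {1..q + 1} - {j}" for a :: "nat \<Rightarrow> nat" and Y :: "nat \<Rightarrow> 'a" and L
  proof (intro arg_cong[of _ _ prod_list] map_cong refl)
    fix x assume "x \<in> set L"
    with that(2) have "q + \<tau> x \<notin> {1..q + 1}" by (intro gt) auto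
    then show "Y (a (q + \<tau> x)) = Y (q + \<tau> x)" using permutes_not_in[OF that(1)] by simp
  qed
  have split: "nested_word q B \<tau> = (\<lambda>X. prod_list (map (\<lambda>i. X (q + \<tau> i)) [1..<j]) * B X *
    prod_list (map (\<lambda>i. X (q + \<tau> i)) [j + 1..<q + 1 + 1]))" for B
    by (rule ext) (rule nested_word_split[OF \<tau> j])
  show ?thesis
    unfolding split
    by (rule alt_absorb[OF assms(2)]; rule map_fix) (use j in auto)
qed

text \<open>
  Exchanging the block \<open>X 1 \<cdots> X (q + 1)\<close> with a neighbouring factor moves \<open>q + 2\<close> letters
  cyclically, which is an even permutation since \<open>q + 1\<close> is even.
\<close>

lemma alt_nested_word_swap:
  assumes \<tau>: "\<tau> permutes {1..q + 1}" and j: "j \<in> {1..q}" "\<tau> j = 1" and q: "odd q"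
  shows "alt ((q + 1) + q) (nested_word q (word (q + 1)) (\<tau> \<circ> transpose j (j + 1))) X =
    alt ((q + 1) + q) (nested_word q (word (q + 1)) \<tau>) X"
proof -
  let ?n = "(q + 1) + q" and ?t = "transpose j (j + 1)"
  \<comment> \<open>The index of the letter just to the right of the block in the
    \<tau>-monomial.\<close>
  define y where "y = q + \<tau> (j + 1)"
  have ne: "\<tau> l \<noteq> 1" if "l \<noteq> j" for l
    using that j(2) permutes_inj[OF \<tau>] by (metis injD)
  have "\<tau> (j + 1) \<in> {1..q + 1}" using permutes_in_image[OF \<tau>] j by auto
  then have y: "q + 1 < y" "y \<le> ?n" using ne[of "j + 1"] by (auto simp: y_def)
  define c where "c = cyc (q + 1) y"
  note c_apply = cyc_apply[OF y(1), folded c_def]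
  have c: "c permutes {1..?n}" unfolding c_def by (rule cyc_permutes[OF y])
  have sc: "sign c = 1" unfolding c_def sign_cyc[OF y(1)] using q by simp
  have t: "?t permutes {1..q + 1}" using j by (intro permutes_swap_id) auto
  have \<tau>t: "\<tau> \<circ> ?t permutes {1..q + 1}" by (rule permutes_compose[OF t \<tau>])
  have j': "j \<in> {1..q + 1}" "j + 1 \<in> {1..q + 1}" using j by auto
  have \<tau>t1: "(\<tau> \<circ> ?t) (j + 1) = 1" using j by simp
  have fix_c: "c (q + \<tau> l) = q + \<tau> l" if "l \<in> {1..q + 1}" "l \<noteq> j" "l \<noteq> j + 1" for l
  proof -
    have "\<tau> l \<noteq> \<tau> (j + 1)" using that permutes_inj[OF \<tau>] by (metis injD)
    moreover have "\<tau> l \<in> {1..q + 1}" using that permutes_in_image[OF \<tau>] by blast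
    ultimately have "q + 1 < q + \<tau> l" "q + \<tau> l \<noteq> y" using ne[OF that(2)] by (auto simp: y_def)
    then show ?thesis unfolding c_apply by simp
  qed
  \<comment> \<open>Substituting along \<open>c\<close>, the neighbour becomes \<open>X 1\<close>
    and the block becomes \<open>X 2\<close>, ..., \<open>X (q + 1)\<close>, \<open>X y\<close>. The
    product is unchanged as a string of letters, but now reads as the block followed by its
    neighbour.\<close>
  have rotate: "X (c y) * word (q + 1) (\<lambda>i. X (c i)) = word (q + 1) X * X y" for X
  proof -
    have c1: "c y = 1" unfolding c_apply using y by simp
    have cq: "c (q + 1) = y" unfolding c_apply by simp
    have "word (q + 1) (\<lambda>i. X (c i)) = prod_list (map (\<lambda>i. X (c i)) [1..<q + 1]) * X y"
      by (simp add: word_def cq[simplified])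
    also have "map (\<lambda>i. X (c i)) [1..<q + 1] = map (\<lambda>i. X (Suc i)) [1..<q + 1]"
      unfolding c_apply by (rule map_cong) auto
    also have "\<dots> = map X [2..<q + 2]"
      by (rule nth_equalityI) (auto simp del: upt_Suc)
    finally have "X (c y) * word (q + 1) (\<lambda>i. X (c i)) = X 1 * prod_list (map X [2..<q + 2]) * X y"
      by (simp only: c1 mult.assoc)
    also have "X 1 * prod_list (map X [2..<q + 2]) = word (q + 1) X"
      using word_split[of 1 "q + 1" X] by (simp add: numeral_2_eq_2)
    finally show ?thesis .
  qed
  have "nested_word q (word (q + 1)) (\<tau> \<circ> ?t) (\<lambda>i. X (c i)) = nested_word q (word (q + 1)) \<tau> X" for X
  proof -
    let ?U = "prod_list (map (\<lambda>i. X (q + \<tau> i)) [1..<j])"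
      and ?V = "prod_list (map (\<lambda>i. X (q + \<tau> i)) [j + 1 + 1..<q + 1 + 1])"
    have "map (\<lambda>i. X (c (q + (\<tau> \<circ> ?t) i))) [1..<j] = map (\<lambda>i. X (q + \<tau> i)) [1..<j]"
      using j by (intro map_cong refl) (auto simp: fix_c)
    moreover have "[1..<j + 1] = [1..<j] @ [j]" using j by simp
    ultimately have 1: "prod_list (map (\<lambda>i. X (c (q + (\<tau> \<circ> ?t) i))) [1..<j + 1]) = ?U * X (c y)"
      by (simp only: map_append prod_list.append) (simp add: y_def)
    have "map (\<lambda>i. X (c (q + (\<tau> \<circ> ?t) i))) [j + 1 + 1..<q + 1 + 1] =
        map (\<lambda>i. X (q + \<tau> i)) [j + 1 + 1..<q + 1 + 1]"
      using j by (intro map_cong refl) (auto simp: fix_c)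
    then have 2: "prod_list (map (\<lambda>i. X (c (q + (\<tau> \<circ> ?t) i))) [j + 1 + 1..<q + 1 + 1]) = ?V"
      by (simp only:)
    have 3: "prod_list (map (\<lambda>i. X (q + \<tau> i)) [j + 1..<q + 1 + 1]) = X y * ?V"
      using j upt_conv_Cons[of "j + 1" "q + 1 + 1"] by (simp add: y_def)
    have "nested_word q (word (q + 1)) (\<tau> \<circ> ?t) (\<lambda>i. X (c i)) =
        ?U * X (c y) * word (q + 1) (\<lambda>i. X (c i)) * ?V"
      unfolding nested_word_split[OF \<tau>t j'(2) \<tau>t1] 1 2 ..
    also have "\<dots> = ?U * (X (c y) * word (q + 1) (\<lambda>i. X (c i))) * ?V"
      by (simp only: mult.assoc)
    also have "\<dots> = ?U * word (q + 1) X * (X y * ?V)"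
      unfolding rotate by (simp only: mult.assoc)
    also have "\<dots> = nested_word q (word (q + 1)) \<tau> X"
      unfolding nested_word_split[OF \<tau> j'(1) j(2)] 3 ..
    finally show ?thesis .
  qed
  then show ?thesis
    using alt_permute_function[OF c, of "nested_word q (word (q + 1)) (\<tau> \<circ> ?t)" X] sc by simp
qed

section \<open>Cancellation over the positions of the block\<close>

lemma sum_alternating_eq_0:
  fixes g :: "nat \<Rightarrow> 'b::ab_group_add"
  assumes "\<And>j. j \<in> {1..<2 * k} \<Longrightarrow> g (j + 1) = - g j"
  shows "sum g {1..2 * k} = 0"
  using assms
proof (induction k)
  case (Suc k)
  have "sum g {1..2 * Suc k} = sum g {1..2 * k} + (g (2 * k + 1) + g (2 * k + 1 + 1))"
    by (simp add: add.assoc)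
  moreover have "g (2 * k + 1 + 1) = - g (2 * k + 1)" by (rule Suc.prems) simp
  moreover have "sum g {1..2 * k} = 0" by (rule Suc.IH, rule Suc.prems) auto
  ultimately show ?case by simp
qed simp

lemma sum_sgnscale_alt_nested_word:
  assumes q: "odd q"
  shows "(\<Sum>\<tau> | \<tau> permutes {1..q + 1}.
    sgnscale \<tau> (alt ((q + 1) + q) (nested_word q (word (q + 1)) \<tau>) X)) = 0"
proof -
  let ?S = "{\<tau>. \<tau> permutes {1..q + 1}}"
  define F where "F \<tau> = sgnscale \<tau> (alt ((q + 1) + q) (nested_word q (word (q + 1)) \<tau>) X)" for \<tau>
  \<comment> \<open>The contribution of all monomials with the block at position
    \<open>j\<close>.\<close>
  define g where "g j = (\<Sum>\<tau>\<in>{\<tau> \<in> ?S. inv \<tau> 1 = j}. F \<tau>)" for j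
  have iff: "inv \<tau> 1 = j \<longleftrightarrow> \<tau> j = 1" if "\<tau> permutes {1..q + 1}" for \<tau> j
    using permutes_inv_eq[OF that] by blast
  have "sum F ?S = sum g {1..q + 1}"
    unfolding g_def
  proof (rule sum.group[symmetric])
    show "(\<lambda>\<tau>. inv \<tau> 1) ` ?S \<subseteq> {1..q + 1}"
    proof clarify
      fix \<tau> :: "nat \<Rightarrow> nat" assume "\<tau> permutes {1..q + 1}"
      from permutes_in_image[OF permutes_inv[OF this], of 1] show "inv \<tau> 1 \<in> {1..q + 1}" by simp
    qed
  qed (simp_all add: finite_permutations)
  also have "\<dots> = 0"
  proof -
    \<comment> \<open>The number of positions is even, so none is left over when they are
      paired.\<close>
    obtain k where k: "q + 1 = 2 * k" using q by (metis even_plus_one_iff evenE)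
    have step: "g (j + 1) = - g j" if j: "j \<in> {1..q}" for j
    proof -
      let ?t = "transpose j (j + 1)"
      have t: "?t permutes {1..q + 1}" using j by (intro permutes_swap_id) auto
      \<comment> \<open>Right composition with the transposition is an involution exchanging the
        \<tau> with block at \<open>j\<close> and those with block at \<open>j + 1\<close>.\<close>
      have "g (j + 1) = (\<Sum>\<tau>\<in>{\<tau> \<in> ?S. inv \<tau> 1 = j}. F (\<tau> \<circ> ?t))"
        unfolding g_def
        by (rule sum.reindex_bij_witness[where i = "\<lambda>\<tau>. \<tau> \<circ> ?t" and j = "\<lambda>\<tau>. \<tau> \<circ> ?t"])
          (auto simp only: mem_Collect_eq comp_assoc transpose_comp_involutory comp_id iff permutes_compose[OF t]
            permutes_inverses(1) comp_apply transpose_apply_first transpose_apply_second)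
      also have "\<dots> = (\<Sum>\<tau>\<in>{\<tau> \<in> ?S. inv \<tau> 1 = j}. - F \<tau>)"
      proof (rule sum.cong)
        fix \<tau> assume "\<tau> \<in> {\<tau> \<in> ?S. inv \<tau> 1 = j}"
        then have \<tau>: "\<tau> permutes {1..q + 1}" "\<tau> j = 1" using iff[of \<tau> j] by blast+
        have st: "sgnscale ?t x = - x" for x by (simp add: sign_swap_id)
        show "F (\<tau> \<circ> ?t) = - F \<tau>"
          unfolding F_def alt_nested_word_swap[OF \<tau>(1) j \<tau>(2) q] sgnscale_compose[OF \<tau>(1) t] st
          by simp
      qed simp
      finally show ?thesis by (simp add: g_def sum_negf)
    qed
    show ?thesis unfolding k by (rule sum_alternating_eq_0, rule step) (use k in auto)
  qed
  finally show ?thesis by (simp add: F_def)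
qed

text \<open>The shuffle sum is shown to vanish after multiplication by the order of the Young
  subgroup, which turns it into a full antisymmetrization.\<close>

lemma sum_shuffle_insert_first:
  assumes q: "odd q"
  defines "A \<equiv> alt (q + 1) (word (q + 1))"
  shows "(\<Sum>\<sigma>\<in>shuffle_perms (q + 1) q. sgnscale \<sigma> (insert_first q A A (\<lambda>i. X (\<sigma> i)))) = 0"
    (is "?S = 0")
proof -
  let ?n = "(q + 1) + q"
  \<comment> \<open>Only the outer \<open>A\<close> is expanded; the inner one stays folded as the
    block.\<close>
  have exp: "insert_first q A A Y = (\<Sum>\<tau> | \<tau> permutes {1..q + 1}. sgnscale \<tau> (nested_word q A \<tau> Y))" for Y
    unfolding insert_first_def nested_word_def by (subst A_def, unfold alt_def) simp
  have "(\<Sum>\<alpha>\<in>young_perms (q + 1) q. ?S) = alt ?n (insert_first q A A) X"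
    unfolding alt_def[of ?n]
    by (rule sum_permutations_shuffle[symmetric]) (unfold A_def, rule insert_first_young)
  also have "\<dots> = (\<Sum>\<tau> | \<tau> permutes {1..q + 1}. sgnscale \<tau> (alt ?n (nested_word q A \<tau>) X))"
    unfolding exp[abs_def] by (rule alt_sum)
  also have "\<dots> = (\<Sum>\<tau> | \<tau> permutes {1..q + 1}. sgnscale \<tau>
      (\<Sum>a | a permutes {1..q + 1}. alt ?n (nested_word q (word (q + 1)) \<tau>) X))"
    unfolding A_def by (rule sum.cong) (simp_all only: mem_Collect_eq alt_nested_word le_add1)
  also have "\<dots> = (\<Sum>a | a permutes {1..q + 1}. \<Sum>\<tau> | \<tau> permutes {1..q + 1}. sgnscale \<tau>
      (alt ?n (nested_word q (word (q + 1)) \<tau>) X))"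
    unfolding scale_sum_right by (rule sum.swap)
  also have "\<dots> = 0" using sum_sgnscale_alt_nested_word[OF q] by simp
  \<comment> \<open>The multiplicity becomes a nonzero complex scalar, which can be
    cancelled.\<close>
  finally have "scale (of_nat (card (young_perms (q + 1) q))) ?S = 0"
    by (simp only: sum_constant_scale)
  moreover have "card (young_perms (q + 1) q) \<noteq> 0"
    using finite_young_perms[of "q + 1" q] id_in_young_perms[of "q + 1" q] by (metis card_0_eq empty_iff)
  ultimately show ?thesis by simp
qed

lemma standard_polynomial_even_Lie_structure:
  assumes "k \<ge> 1"
  shows "even_Lie_structure scale k (standard_polynomial scale (2 * k))"
proof -
  define q where "q = 2 * k - 1"
  have q: "odd q" "2 * k = q + 1" using assms by (auto simp: q_def)
  \<comment> \<open>With equal arguments and equal arities both sums of the bracket are the same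
    shuffle sum, so each is zero whatever the sign in front.\<close>
  have "skew_bracket scale q q (standard_polynomial scale (q + 1)) (standard_polynomial scale (q + 1))
      = (\<lambda>_. 0)"
    unfolding skew_bracket_def standard_polynomial_alt sum_shuffle_insert_first[OF q(1)] by simp
  then show ?thesis
    unfolding even_Lie_structure_def
    using alt_word_skew_multilinear[of "2 * k"] q by (simp add: standard_polynomial_alt)
qed

end

theorem proposition4p2p2:
  fixes scale :: "complex \<Rightarrow> 'a::{ring, monoid_mult} \<Rightarrow> 'a" and k :: nat
  assumes "unital_complex_algebra scale"
    and "k \<ge> 1"
  shows "even_Lie_structure scale k (standard_polynomial scale (2 * k))"
  using assms by (rule unital_complex_algebra.standard_polynomial_even_Lie_structure)

end
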